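(* Each of the following four properties of stochastic tournaments is easily $L_1$-testable: (1) the Bradley--Terry condition: there exist positive reals $(a(x))_{x\in V(K)}$ with $\frac{p_{xy}}{p_{yx}}=\frac{a(x)}{a(y)}$ for all distinct $x,y$; (2) the Markov chain with transition matrix $Q$ is reversible, i.e. there is a probability distribution $(\pi_x)$ on $V(K)$ with $\pi_x q_{xy}=\pi_y q_{yx}$ for all $x,y$; (3) every triangle is balanced: $p_{xy}p_{yz}p_{zx}=p_{xz}p_{zy}p_{yx}$ for all distinct $x,y,z$; (4) there is a vertex $r$ such that every triangle containing $r$ is balanced.
   Context: A tournament $K$ is a complete graph on $n$ vertices with every edge directed. A stochastic tournament is a pair $(K,w)$ with $w:E(K)\to(0,1)$. Its matrix $P=(p_{xy})$ is given by $p_{xy}=w(xy)$, $p_{yx}=1-w(xy)$ whenever the directed edge $xy$ (from $x$ to $y$) is in $E(K)$. The matrix $Q=(q_{xy})$ is $q_{xy}=p_{xy}/n$ for $x\ne y$ and $q_{xx}=1-\frac1n\sum_{z\ne x}p_{xz}$. A property $\mathcal P$ is a class of stochastic tournaments closed under isomorphism. A stochastic tournament $(K,w)$ on $n$ vertices is $\epsilon$-far from $\mathcal P$ if $\sum_{e\in E(K)}|w(e)-w'(e)|\ge \epsilon n^2$ for every $w'$ with $(K,w')\in\mathcal P$. An $\epsilon$-tester for $\mathcal P$ is a randomized algorithm which, able to query the value $p_{xy}$ for any pair $x,y$ in one step, distinguishes with probability at least $2/3$ between the cases that the input satisfies $\mathcal P$ and that it is $\epsilon$-far from $\mathcal P$;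 it is one-sided if it accepts with probability $1$ every input satisfying $\mathcal P$. $\mathcal P$ is easily $L_1$-testable if for every fixed $\epsilon>0$ there is a one-sided $\epsilon$-tester whose number of queries is bounded by a polynomial in $\epsilon^{-1}$, independent of the size of the input. *)

theory Defs
  imports "HOL-Probability.Probability" "HOL-Computational_Algebra.Polynomial"
    "Graph_Theory.Pair_Digraph"
begin

section \<open>Stochastic tournaments\<close>

definition tournament :: "'a pair_pre_digraph \<Rightarrow> bool" where
  "tournament K \<longleftrightarrow> pair_digraph K \<and> pverts K \<noteq> {} \<and>
    (\<forall>x\<in>pverts K. \<forall>y\<in>pverts K. x \<noteq> y \<longrightarrow> ((x, y) \<in> parcs K \<longleftrightarrow> (y, x) \<notin> parcs K))"

text \<open>A pair \<open>(K, w)\<close>. Only the values of \<open>w\<close> on the arcs of \<open>K\<close> are meaningful: an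
  isomorphism compares no others, so membership in an isomorphism-closed class does not depend on
  them.\<close>

type_synonym 'a stoch = "'a pair_pre_digraph \<times> ('a \<times> 'a \<Rightarrow> real)"

definition verts_of :: "'a stoch \<Rightarrow> 'a set" where
  "verts_of T = pverts (fst T)"

definition stochastic_tournament :: "'a stoch \<Rightarrow> bool" where
  "stochastic_tournament T \<longleftrightarrow>
    tournament (fst T) \<and> (\<forall>e\<in>parcs (fst T). 0 < snd T e \<and> snd T e < 1)"

text \<open>The matrix \<open>P\<close> is only specified off the diagonal. The remaining entries are set to \<open>0\<close>.\<close>

definition pmatrix :: "'a stoch \<Rightarrow> 'a \<Rightarrow> 'a \<Rightarrow> real" where
  "pmatrix T x y =
    (if (x, y) \<in> parcs (fst T) then snd T (x, y)
     else if (y, x) \<in> parcs (fst T) then 1 - snd T (y, x) else 0)"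

definition qmatrix :: "'a stoch \<Rightarrow> 'a \<Rightarrow> 'a \<Rightarrow> real" where
  "qmatrix T x y =
    (if x \<noteq> y then pmatrix T x y / real (card (verts_of T))
     else 1 - 1 / real (card (verts_of T)) * (\<Sum>z\<in>verts_of T - {x}. pmatrix T x z))"


section \<open>Properties and distance\<close>

definition stoch_iso :: "'a stoch \<Rightarrow> 'a stoch \<Rightarrow> bool" where
  "stoch_iso T T' \<longleftrightarrow> (\<exists>f. bij_betw f (verts_of T) (verts_of T') \<and>
    (\<forall>x\<in>verts_of T. \<forall>y\<in>verts_of T. (x, y) \<in> parcs (fst T) \<longleftrightarrow> (f x, f y) \<in> parcs (fst T')) \<and>
    (\<forall>(x, y)\<in>parcs (fst T). snd T' (f x, f y) = snd T (x, y)))"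

definition is_property :: "'a stoch set \<Rightarrow> bool" where
  "is_property \<P> \<longleftrightarrow> (\<forall>T\<in>\<P>. stochastic_tournament T) \<and>
    (\<forall>T\<in>\<P>. \<forall>T'. stochastic_tournament T' \<longrightarrow> stoch_iso T T' \<longrightarrow> T' \<in> \<P>)"

definition eps_far :: "real \<Rightarrow> 'a stoch set \<Rightarrow> 'a stoch \<Rightarrow> bool" where
  "eps_far \<epsilon> \<P> T \<longleftrightarrow> (\<forall>w'. (fst T, w') \<in> \<P> \<longrightarrow>
    (\<Sum>e\<in>parcs (fst T). \<bar>snd T e - w' e\<bar>) \<ge> \<epsilon> * real (card (verts_of T)) ^ 2)"


section \<open>Testers\<close>

text \<open>A deterministic query algorithm is a decision tree: each step either stops with a verdict
  (\<open>True\<close> means accept) or queries one entry of the input matrix and continues depending on the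
  answer. A randomized algorithm is a probability distribution on decision trees that may depend
  on the vertex set of the input, but that learns about the arcs and weights only by queries.\<close>

datatype 'a decision_tree =
    Verdict bool
  | Query 'a 'a "real \<Rightarrow> 'a decision_tree"

primrec accepts :: "('a \<Rightarrow> 'a \<Rightarrow> real) \<Rightarrow> 'a decision_tree \<Rightarrow> bool" where
  "accepts p (Verdict b) = b"
| "accepts p (Query x y k) = accepts p (k (p x y))"

primrec num_queries :: "('a \<Rightarrow> 'a \<Rightarrow> real) \<Rightarrow> 'a decision_tree \<Rightarrow> nat" where
  "num_queries p (Verdict b) = 0"
| "num_queries p (Query x y k) = Suc (num_queries p (k (p x y)))"

type_synonym 'a query_algorithm = "'a set \<Rightarrow> 'a decision_tree pmf"

definition accept_prob :: "'a query_algorithm \<Rightarrow> 'a stoch \<Rightarrow> real" where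
  "accept_prob A T = measure_pmf.prob (A (verts_of T)) {t. accepts (pmatrix T) t}"

definition reject_prob :: "'a query_algorithm \<Rightarrow> 'a stoch \<Rightarrow> real" where
  "reject_prob A T = measure_pmf.prob (A (verts_of T)) {t. \<not> accepts (pmatrix T) t}"

definition eps_tester :: "real \<Rightarrow> 'a stoch set \<Rightarrow> 'a query_algorithm \<Rightarrow> bool" where
  "eps_tester \<epsilon> \<P> A \<longleftrightarrow> (\<forall>T. stochastic_tournament T \<longrightarrow>
    (T \<in> \<P> \<longrightarrow> accept_prob A T \<ge> 2/3) \<and> (eps_far \<epsilon> \<P> T \<longrightarrow> reject_prob A T \<ge> 2/3))"

definition one_sided :: "'a stoch set \<Rightarrow> 'a query_algorithm \<Rightarrow> bool" where
  "one_sided \<P> A \<longleftrightarrow> (\<forall>T\<in>\<P>. accept_prob A T = 1)"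

text \<open>The number of queries is bounded for every input and every outcome of the random choices.\<close>

definition queries_bounded :: "'a query_algorithm \<Rightarrow> real \<Rightarrow> bool" where
  "queries_bounded A B \<longleftrightarrow> (\<forall>T. stochastic_tournament T \<longrightarrow>
    (\<forall>t\<in>set_pmf (A (verts_of T)). real (num_queries (pmatrix T) t) \<le> B))"

definition easily_L1_testable :: "'a stoch set \<Rightarrow> bool" where
  "easily_L1_testable \<P> \<longleftrightarrow> is_property \<P> \<and>
    (\<exists>f :: real poly. \<forall>\<epsilon>>0. \<exists>A. eps_tester \<epsilon> \<P> A \<and> one_sided \<P> A \<and>
      queries_bounded A (poly f (1 / \<epsilon>)))"


section \<open>The four properties\<close>

definition Bradley_Terry :: "'a stoch set" where
  "Bradley_Terry = {T. stochastic_tournament T \<and>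
    (\<exists>a :: 'a \<Rightarrow> real. (\<forall>x\<in>verts_of T. a x > 0) \<and>
      (\<forall>x\<in>verts_of T. \<forall>y\<in>verts_of T. x \<noteq> y \<longrightarrow>
        pmatrix T x y / pmatrix T y x = a x / a y))}"

definition reversible_chain :: "'a set \<Rightarrow> ('a \<Rightarrow> 'a \<Rightarrow> real) \<Rightarrow> bool" where
  "reversible_chain V q \<longleftrightarrow> (\<exists>\<pi> :: 'a pmf. set_pmf \<pi> \<subseteq> V \<and>
    (\<forall>x\<in>V. \<forall>y\<in>V. pmf \<pi> x * q x y = pmf \<pi> y * q y x))"

definition Reversible :: "'a stoch set" where
  "Reversible = {T. stochastic_tournament T \<and> reversible_chain (verts_of T) (qmatrix T)}"

definition balanced_triangle :: "'a stoch \<Rightarrow> 'a \<Rightarrow> 'a \<Rightarrow> 'a \<Rightarrow> bool" where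
  "balanced_triangle T x y z \<longleftrightarrow>
    pmatrix T x y * pmatrix T y z * pmatrix T z x = pmatrix T x z * pmatrix T z y * pmatrix T y x"

definition All_Balanced :: "'a stoch set" where
  "All_Balanced = {T. stochastic_tournament T \<and>
    (\<forall>x\<in>verts_of T. \<forall>y\<in>verts_of T. \<forall>z\<in>verts_of T.
      distinct [x, y, z] \<longrightarrow> balanced_triangle T x y z)}"

definition Balanced_At_Vertex :: "'a stoch set" where
  "Balanced_At_Vertex = {T. stochastic_tournament T \<and>
    (\<exists>r\<in>verts_of T. \<forall>x\<in>verts_of T. \<forall>y\<in>verts_of T. \<forall>z\<in>verts_of T.
      distinct [x, y, z] \<and> r \<in> {x, y, z} \<longrightarrow> balanced_triangle T x y z)}"

end

theory Submission
  imports Defs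
begin

text \<open>All four properties coincide: reversibility with respect to \<open>\<pi>\<close> is the Bradley--Terry
  condition for \<open>a = 1 / \<pi>\<close>, and if all triangles at \<open>r\<close> are balanced then
  \<open>a x = p\<^sub>x\<^sub>r / p\<^sub>r\<^sub>x\<close> is a Bradley--Terry vector. For an arbitrary input, this same vector
  defines a Bradley--Terry tournament that differs from the input only at pairs \<open>xy\<close> for which
  the triangle \<open>rxy\<close> is unbalanced, and there by at most \<open>1\<close>. So if the input is \<open>\<epsilon>\<close>-far, then for
  every fixed \<open>r\<close> at least \<open>\<epsilon> n\<^sup>2\<close> of the pairs are unbalanced with \<open>r\<close>, and
  \<open>O(1 / \<epsilon>)\<close> uniformly random pairs reveal one of them with probability at least \<open>2/3\<close>.\<close>

section \<open>The matrix of a stochastic tournament\<close>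

lemma stochastic_tournament_finite:
  assumes "stochastic_tournament T"
  shows "finite (verts_of T)" "verts_of T \<noteq> {}"
proof -
  interpret pair_digraph "fst T"
    using assms by (simp add: stochastic_tournament_def tournament_def)
  show "finite (verts_of T)" "verts_of T \<noteq> {}"
    using assms by (simp_all add: verts_of_def stochastic_tournament_def tournament_def)
qed

lemma stochastic_tournament_arc:
  assumes "stochastic_tournament T" "(x, y) \<in> parcs (fst T)"
  shows "x \<in> verts_of T" "y \<in> verts_of T" "x \<noteq> y"
proof -
  interpret pair_digraph "fst T"
    using assms by (simp add: stochastic_tournament_def tournament_def)
  show "x \<in> verts_of T" "y \<in> verts_of T" "x \<noteq> y"
    using assms(2) in_arcsD1 in_arcsD2 no_loops by (force simp: verts_of_def)+
qed

lemma stochastic_tournament_arcs_cases: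
  assumes "stochastic_tournament T" "x \<in> verts_of T" "y \<in> verts_of T" "x \<noteq> y"
  obtains "(x, y) \<in> parcs (fst T)" "(y, x) \<notin> parcs (fst T)"
  | "(y, x) \<in> parcs (fst T)" "(x, y) \<notin> parcs (fst T)"
  using assms unfolding stochastic_tournament_def tournament_def verts_of_def by metis

lemma pmatrix_diag [simp]:
  assumes "stochastic_tournament T"
  shows "pmatrix T x x = 0"
  using stochastic_tournament_arc(3)[OF assms] by (auto simp: pmatrix_def)

lemma pmatrix_pos:
  assumes "stochastic_tournament T" "x \<in> verts_of T" "y \<in> verts_of T" "x \<noteq> y"
  shows "pmatrix T x y > 0"
  by (rule stochastic_tournament_arcs_cases[OF assms])
    (use assms(1) in \<open>auto simp: pmatrix_def stochastic_tournament_def\<close>)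

lemma pmatrix_add_swap:
  assumes "stochastic_tournament T" "x \<in> verts_of T" "y \<in> verts_of T" "x \<noteq> y"
  shows "pmatrix T x y + pmatrix T y x = 1"
  by (rule stochastic_tournament_arcs_cases[OF assms]) (auto simp: pmatrix_def)

text \<open>If two of the vertices coincide, both products contain a diagonal entry, which is 0 by
  convention. This makes distinctness conditions disappear later and allows sampling pairs with
  repetitions.\<close>

lemma balanced_triangle_degenerate:
  assumes "stochastic_tournament T" "\<not> distinct [x, y, z]"
  shows "balanced_triangle T x y z"
  using assms by (auto simp: balanced_triangle_def)

section \<open>Invariance under isomorphism\<close>

lemma pmatrix_iso:
  assumes "\<forall>x\<in>V. \<forall>y\<in>V. (x, y) \<in> parcs (fst T) \<longleftrightarrow> (f x, f y) \<in> parcs (fst T')"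
    and "\<forall>(x, y)\<in>parcs (fst T). snd T' (f x, f y) = snd T (x, y)"
    and "x \<in> V" "y \<in> V"
  shows "pmatrix T' (f x) (f y) = pmatrix T x y"
  using assms by (auto simp: pmatrix_def)

text \<open>Balance only involves matrix entries, and these are preserved by
  \<open>pmatrix_iso\<close>. Closure is checked for this class alone, since the other three turn
  out to be equal to it.\<close>

lemma is_property_All_Balanced: "is_property All_Balanced"
  unfolding is_property_def
proof (intro conjI ballI allI impI)
  fix T T' :: "'a stoch"
  assume T: "T \<in> All_Balanced" and T': "stochastic_tournament T'" and "stoch_iso T T'"
  then obtain f where f: "bij_betw f (verts_of T) (verts_of T')"
    "\<forall>x\<in>verts_of T. \<forall>y\<in>verts_of T. (x, y) \<in> parcs (fst T) \<longleftrightarrow> (f x, f y) \<in> parcs (fst T')"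
    "\<forall>(x, y)\<in>parcs (fst T). snd T' (f x, f y) = snd T (x, y)"
    unfolding stoch_iso_def by auto
  note p = pmatrix_iso[OF f(2,3)]
  have "balanced_triangle T' (f x) (f y) (f z)"
    if "x \<in> verts_of T" "y \<in> verts_of T" "z \<in> verts_of T" "distinct [f x, f y, f z]" for x y z
  proof -
    have "distinct [x, y, z]"
      using that(4) by auto
    then have "balanced_triangle T x y z"
      using T that(1-3) by (simp add: All_Balanced_def)
    then show ?thesis
      using that by (simp add: balanced_triangle_def p)
  qed
  moreover have "verts_of T' = f ` verts_of T"
    using f(1) by (simp add: bij_betw_def)
  ultimately show "T' \<in> All_Balanced"
    using T' by (simp add: All_Balanced_def)
qed (simp add: All_Balanced_def)


section \<open>Equivalence of the four properties\<close>

text \<open>The Bradley--Terry condition in cross-multiplied form: no quotients occur, and the case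
  of equal vertices holds trivially.\<close>

definition odds_vector :: "'a stoch \<Rightarrow> ('a \<Rightarrow> real) \<Rightarrow> bool" where
  "odds_vector T a \<longleftrightarrow> (\<forall>x\<in>verts_of T. a x > 0) \<and>
    (\<forall>x\<in>verts_of T. \<forall>y\<in>verts_of T. pmatrix T x y * a y = pmatrix T y x * a x)"

lemma Bradley_Terry_iff:
  "T \<in> Bradley_Terry \<longleftrightarrow> stochastic_tournament T \<and> (\<exists>a. odds_vector T a)"
proof -
  have eq: "(x \<noteq> y \<longrightarrow> pmatrix T x y / pmatrix T y x = a x / a y) \<longleftrightarrow>
      pmatrix T x y * a y = pmatrix T y x * a x"
    if "stochastic_tournament T" "\<forall>x\<in>verts_of T. a x > 0" "x \<in> verts_of T" "y \<in> verts_of T"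
    for x y and a :: "'a \<Rightarrow> real"
  proof (cases "x = y")
    case False
    then have "pmatrix T y x > 0" "a y > 0"
      using that pmatrix_pos[of T y x] by auto
    then show ?thesis
      using False by (simp add: frac_eq_eq mult.commute)
  qed simp
  show ?thesis
  proof
    assume "T \<in> Bradley_Terry"
    then obtain a where T: "stochastic_tournament T" and pos: "\<forall>x\<in>verts_of T. a x > 0"
      and a: "\<And>x y. x \<in> verts_of T \<Longrightarrow> y \<in> verts_of T \<Longrightarrow>
        x \<noteq> y \<longrightarrow> pmatrix T x y / pmatrix T y x = a x / a y"
      by (auto simp: Bradley_Terry_def)
    have "odds_vector T a"
      unfolding odds_vector_def using pos a by (simp add: eq[OF T pos])
    then show "stochastic_tournament T \<and> (\<exists>a. odds_vector T a)"
      using T by blast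
  next
    assume "stochastic_tournament T \<and> (\<exists>a. odds_vector T a)"
    then obtain a where T: "stochastic_tournament T" and pos: "\<forall>x\<in>verts_of T. a x > 0"
      and a: "\<And>x y. x \<in> verts_of T \<Longrightarrow> y \<in> verts_of T \<Longrightarrow>
        pmatrix T x y * a y = pmatrix T y x * a x"
      by (auto simp: odds_vector_def)
    have "\<forall>x\<in>verts_of T. \<forall>y\<in>verts_of T. x \<noteq> y \<longrightarrow>
        pmatrix T x y / pmatrix T y x = a x / a y"
      by (intro ballI) (simp only: eq[OF T pos] a)
    then show "T \<in> Bradley_Terry"
      using T pos by (auto simp: Bradley_Terry_def)
  qed
qed

text \<open>The ratios of opposite entries along the cycle x, y, z multiply to 1, because the
  quotients of values of \<open>a\<close> telescope.\<close>

lemma odds_vector_balanced: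
  assumes "odds_vector T a" "x \<in> verts_of T" "y \<in> verts_of T" "z \<in> verts_of T"
  shows "balanced_triangle T x y z"
proof -
  have "a x \<noteq> 0" "a y \<noteq> 0" "a z \<noteq> 0"
    and *: "pmatrix T x y = pmatrix T y x * a x / a y"
      "pmatrix T y z = pmatrix T z y * a y / a z"
      "pmatrix T z x = pmatrix T x z * a z / a x"
    using assms by (auto simp: odds_vector_def field_simps less_le)
  then show ?thesis
    unfolding balanced_triangle_def * by simp
qed

text \<open>Up to scaling, the only candidate for a Bradley--Terry vector: normalising it to 1 at
  \<open>r\<close> forces all other values. The case \<open>x = r\<close> is separate because the
  quotient there would be 0 / 0, which evaluates to 0 and is not positive.\<close>

definition odds_at :: "'a stoch \<Rightarrow> 'a \<Rightarrow> 'a \<Rightarrow> real" where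
  "odds_at T r x = (if x = r then 1 else pmatrix T x r / pmatrix T r x)"

lemma odds_at_pos:
  assumes "stochastic_tournament T" "r \<in> verts_of T" "x \<in> verts_of T"
  shows "odds_at T r x > 0"
  using pmatrix_pos[of T x r] pmatrix_pos[of T r x] assms by (simp add: odds_at_def)

text \<open>Away from \<open>r\<close>, clearing the denominators \<open>pmatrix T r x\<close> and
  \<open>pmatrix T r y\<close> turns the claim into exactly the balance equation of the triangle. If
  \<open>x\<close> or \<open>y\<close> is \<open>r\<close>, it holds by the choice of
  \<open>odds_at\<close>.\<close>

lemma odds_at_balanced:
  assumes T: "stochastic_tournament T"
    and V: "r \<in> verts_of T" "x \<in> verts_of T" "y \<in> verts_of T"
    and bal: "balanced_triangle T r x y"
  shows "pmatrix T x y * odds_at T r y = pmatrix T y x * odds_at T r x"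
proof -
  have "pmatrix T r v > 0" if "v \<in> verts_of T" "v \<noteq> r" for v
    using pmatrix_pos[OF T V(1) that(1)] that(2) by simp
  then show ?thesis
    using bal V by (auto simp: odds_at_def balanced_triangle_def field_simps less_le)
qed

section \<open>Detailed balance and the Bradley--Terry condition\<close>

lemma Reversible_imp_Bradley_Terry:
  assumes "T \<in> Reversible"
  shows "T \<in> Bradley_Terry"
proof -
  have T: "stochastic_tournament T"
    using assms by (simp add: Reversible_def)
  obtain \<pi> where sub: "set_pmf \<pi> \<subseteq> verts_of T"
    and rev: "\<And>x y. x \<in> verts_of T \<Longrightarrow> y \<in> verts_of T \<Longrightarrow>
      pmf \<pi> x * qmatrix T x y = pmf \<pi> y * qmatrix T y x"
    using assms by (auto simp: Reversible_def reversible_chain_def)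
  have "card (verts_of T) > 0"
    using stochastic_tournament_finite[OF T] by (simp add: card_gt_0_iff)
  then have bal: "pmf \<pi> x * pmatrix T x y = pmf \<pi> y * pmatrix T y x"
    if "x \<in> verts_of T" "y \<in> verts_of T" for x y
    using rev[OF that] by (cases "x = y") (auto simp: qmatrix_def)
  obtain v where v: "v \<in> set_pmf \<pi>"
    using set_pmf_not_empty[of \<pi>] by blast
  \<comment> \<open>A stationary distribution might vanish somewhere a priori. But some vertex
    \<open>v\<close> carries mass, and since all off-diagonal entries are positive, detailed balance
    with \<open>v\<close> forces mass on every vertex.\<close>
  have pos: "pmf \<pi> x > 0" if x: "x \<in> verts_of T" for x
  proof (cases "x = v")
    case False
    then have "pmf \<pi> v * pmatrix T v x > 0"
      using v sub x by (intro mult_pos_pos pmatrix_pos[OF T]) (auto simp: pmf_positive)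
    then show ?thesis
      using bal[of v x] v sub x by (auto simp: less_le)
  qed (use v in \<open>simp add: pmf_positive\<close>)
  \<comment> \<open>Detailed balance makes the odds of x against y equal to the mass of y over the
    mass of x, hence the reciprocals.\<close>
  then have "odds_vector T (\<lambda>x. 1 / pmf \<pi> x)"
    using bal by (auto simp: odds_vector_def field_simps less_le)
  then show ?thesis
    using T by (auto simp: Bradley_Terry_iff)
qed

lemma Bradley_Terry_imp_Reversible:
  assumes "T \<in> Bradley_Terry"
  shows "T \<in> Reversible"
proof -
  obtain a where T: "stochastic_tournament T" and a: "odds_vector T a"
    using assms by (auto simp: Bradley_Terry_iff)
  note fin = stochastic_tournament_finite[OF T]
  define s where "s = (\<Sum>x\<in>verts_of T. 1 / a x)"
  have s: "s > 0"
    unfolding s_def using fin a by (intro sum_pos) (auto simp: odds_vector_def)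
  \<comment> \<open>The reciprocals of \<open>a\<close>, normalised to total mass 1 and extended by
    0 to the whole type, as a \<open>pmf\<close> requires.\<close>
  define g where "g x = (if x \<in> verts_of T then 1 / a x / s else 0)" for x
  have nonneg: "g x \<ge> 0" for x
    using a s by (auto simp: g_def odds_vector_def less_imp_le)
  have "(\<integral>\<^sup>+x. ennreal (g x) \<partial>count_space UNIV) = (\<Sum>x\<in>verts_of T. ennreal (g x))"
    using fin(1) by (intro nn_integral_count_space'[where A = "verts_of T"]) (auto simp: g_def)
  also have "\<dots> = ennreal (\<Sum>x\<in>verts_of T. g x)"
    using nonneg by simp
  also have "(\<Sum>x\<in>verts_of T. g x) = (\<Sum>x\<in>verts_of T. 1 / a x) / s"
    by (simp only: g_def sum_divide_distrib if_True cong: sum.cong)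
  also have "\<dots> = 1"
    using s by (simp add: s_def)
  also have "ennreal 1 = 1"
    by simp
  finally have sum1: "(\<integral>\<^sup>+x. ennreal (g x) \<partial>count_space UNIV) = 1" .
  define \<pi> where "\<pi> = embed_pmf g"
  have \<pi>: "pmf \<pi> x = g x" for x
    unfolding \<pi>_def by (rule pmf_embed_pmf[OF nonneg sum1])
  have "pmf \<pi> x * qmatrix T x y = pmf \<pi> y * qmatrix T y x"
    if V: "x \<in> verts_of T" "y \<in> verts_of T" for x y
  proof (cases "x = y")
    case False
    have "a x > 0" "a y > 0" "pmatrix T x y * a y = pmatrix T y x * a x"
      using a V by (auto simp: odds_vector_def)
    then have "pmatrix T x y / a x = pmatrix T y x / a y"
      by (simp add: frac_eq_eq)
    then have "pmatrix T x y / a x / (s * card (verts_of T)) =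
        pmatrix T y x / a y / (s * card (verts_of T))"
      by simp
    then show ?thesis
      using V False by (simp add: \<pi> g_def qmatrix_def ac_simps)
  qed simp
  moreover have "set_pmf \<pi> \<subseteq> verts_of T"
    by (auto simp: set_pmf_iff \<pi> g_def split: if_splits)
  ultimately show ?thesis
    using T by (auto simp: Reversible_def reversible_chain_def)
qed

section \<open>Balanced triangles and the Bradley--Terry condition\<close>

lemma All_Balanced_iff:
  "T \<in> All_Balanced \<longleftrightarrow> stochastic_tournament T \<and>
    (\<forall>x\<in>verts_of T. \<forall>y\<in>verts_of T. \<forall>z\<in>verts_of T. balanced_triangle T x y z)"
proof (cases "stochastic_tournament T")
  case True
  have "(distinct [x, y, z] \<longrightarrow> balanced_triangle T x y z) \<longleftrightarrow> balanced_triangle T x y z" for x y z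
    using balanced_triangle_degenerate[OF True] by blast
  then show ?thesis
    by (simp only: All_Balanced_def mem_Collect_eq)
qed (simp add: All_Balanced_def)

lemma Balanced_At_Vertex_imp_Bradley_Terry:
  assumes "T \<in> Balanced_At_Vertex"
  shows "T \<in> Bradley_Terry"
proof -
  obtain r where T: "stochastic_tournament T" and r: "r \<in> verts_of T"
    and "\<forall>x\<in>verts_of T. \<forall>y\<in>verts_of T. \<forall>z\<in>verts_of T.
      distinct [x, y, z] \<and> r \<in> {x, y, z} \<longrightarrow> balanced_triangle T x y z"
    using assms by (auto simp: Balanced_At_Vertex_def)
  then have "balanced_triangle T r x y" if "x \<in> verts_of T" "y \<in> verts_of T" for x y
    using that balanced_triangle_degenerate[OF T, of r x y] by blast
  then have "odds_vector T (odds_at T r)"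
    unfolding odds_vector_def using odds_at_pos[OF T r] odds_at_balanced[OF T r] by blast
  then show ?thesis
    using T by (auto simp: Bradley_Terry_iff)
qed

lemma Bradley_Terry_eq_All_Balanced: "Bradley_Terry = All_Balanced"
  and Balanced_At_Vertex_eq_All_Balanced: "Balanced_At_Vertex = All_Balanced"
proof -
  have "Bradley_Terry \<subseteq> All_Balanced"
    using odds_vector_balanced by (fastforce simp: All_Balanced_iff Bradley_Terry_iff)
  \<comment> \<open>The vertex \<open>r\<close> exists because a tournament has a nonempty vertex
    set.\<close>
  moreover have "All_Balanced \<subseteq> Balanced_At_Vertex"
    using stochastic_tournament_finite(2) by (fastforce simp: All_Balanced_iff Balanced_At_Vertex_def)
  moreover have "Balanced_At_Vertex \<subseteq> Bradley_Terry"
    using Balanced_At_Vertex_imp_Bradley_Terry by blast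
  ultimately show "Bradley_Terry = All_Balanced" "Balanced_At_Vertex = All_Balanced"
    by blast+
qed

lemma Reversible_eq_All_Balanced: "Reversible = All_Balanced"
  using Reversible_imp_Bradley_Terry Bradley_Terry_imp_Reversible Bradley_Terry_eq_All_Balanced
  by blast


section \<open>Unbalanced triangles at a vertex of a far tournament\<close>

text \<open>Ordered pairs are counted, so that the bound says that unbalanced pairs have density at
  least \<epsilon> in the square of the vertex set, from which the tester samples uniformly.\<close>

lemma eps_far_card_unbalanced:
  assumes T: "stochastic_tournament T" and r: "r \<in> verts_of T"
    and far: "eps_far \<epsilon> Bradley_Terry T"
  shows "\<epsilon> * real (card (verts_of T)) ^ 2 \<le>
    real (card {(x, y) \<in> verts_of T \<times> verts_of T. \<not> balanced_triangle T r x y})"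
    (is "_ \<le> real (card ?B)")
proof -
  let ?a = "odds_at T r"
  \<comment> \<open>The unique weight p with p / (1 - p) equal to the ratio of the two odds.\<close>
  define w' where "w' = (\<lambda>(x, y). ?a x / (?a x + ?a y))"
  define T' where "T' = (fst T, w')"
  have a: "?a x > 0" if "x \<in> verts_of T" for x
    using odds_at_pos[OF T r that] .
  have verts: "verts_of T' = verts_of T"
    by (simp add: T'_def verts_of_def)
  have w'01: "0 < w' (x, y)" "w' (x, y) < 1" if "x \<in> verts_of T" "y \<in> verts_of T" for x y
    using a[OF that(1)] a[OF that(2)] by (simp_all add: w'_def)
  have w01: "0 < snd T e" "snd T e < 1" if "e \<in> parcs (fst T)" for e
    using that T by (auto simp: stochastic_tournament_def)
  have T': "stochastic_tournament T'"
    using T w'01 stochastic_tournament_arc[OF T]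
    by (auto simp: T'_def stochastic_tournament_def)
  \<comment> \<open>The orientation of the arc is irrelevant, since the values of this formula at
    (x, y) and (y, x) add up to 1.\<close>
  have p': "pmatrix T' x y = ?a x / (?a x + ?a y)"
    if V: "x \<in> verts_of T" "y \<in> verts_of T" "x \<noteq> y" for x y
    using T V
  proof (cases rule: stochastic_tournament_arcs_cases)
    case 1
    then show ?thesis
      by (simp add: pmatrix_def T'_def w'_def)
  next
    case 2
    then have "pmatrix T' x y = 1 - ?a y / (?a y + ?a x)"
      by (simp add: pmatrix_def T'_def w'_def)
    then show ?thesis
      using a[OF V(1)] a[OF V(2)] by (simp add: field_simps)
  qed
  have "pmatrix T' x y * ?a y = pmatrix T' y x * ?a x"
    if "x \<in> verts_of T" "y \<in> verts_of T" for x y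
    using p'[OF that] p'[OF that(2,1)] by (cases "x = y") (simp_all add: add.commute mult.commute)
  then have "odds_vector T' ?a"
    using a by (simp add: odds_vector_def verts)
  then have "(fst T, w') \<in> Bradley_Terry"
    using T' by (auto simp: Bradley_Terry_iff T'_def)
  then have "\<epsilon> * real (card (verts_of T)) ^ 2 \<le> (\<Sum>e\<in>parcs (fst T). \<bar>snd T e - w' e\<bar>)"
    using far by (simp add: eps_far_def)
  \<comment> \<open>On an unbalanced pair, both weights lie between 0 and 1 and so differ by at most
    1; on a balanced pair they agree.\<close>
  also have "\<dots> \<le> (\<Sum>e\<in>parcs (fst T). if e \<in> ?B then 1 else 0)"
  proof (rule sum_mono)
    fix e
    assume e: "e \<in> parcs (fst T)"
    obtain x y where xy: "e = (x, y)"
      by (cases e)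
    note V = stochastic_tournament_arc[OF T e[unfolded xy]]
    show "\<bar>snd T e - w' e\<bar> \<le> (if e \<in> ?B then 1 else 0)"
    proof (cases "e \<in> ?B")
      case True
      then show ?thesis
        using w01[OF e] w'01[OF V(1,2)] xy by auto
    next
      case False
      have "pmatrix T x y * ?a y = pmatrix T y x * ?a x"
        using False V xy by (intro odds_at_balanced[OF T r]) auto
      moreover have "pmatrix T y x = 1 - pmatrix T x y" "pmatrix T x y = snd T e"
        using pmatrix_add_swap[OF T V] e xy by (auto simp: pmatrix_def)
      \<comment> \<open>With p the weight of the arc, this solves the linear equation
        \<open>p * ?a y = (1 - p) * ?a x\<close> for p.\<close>
      ultimately have "snd T e = w' e"
        using a[OF V(1)] a[OF V(2)] xy by (simp add: w'_def field_simps)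
      then show ?thesis
        by simp
    qed
  qed
  also have "\<dots> \<le> real (card ?B)"
  proof -
    have sub: "parcs (fst T) \<subseteq> verts_of T \<times> verts_of T"
      using stochastic_tournament_arc[OF T] by auto
    have fin: "finite (verts_of T \<times> verts_of T)"
      using stochastic_tournament_finite[OF T] by simp
    have "(\<Sum>e\<in>parcs (fst T). if e \<in> ?B then 1 else (0::real)) =
        real (card (parcs (fst T) \<inter> ?B))"
      using finite_subset[OF sub fin] by (simp add: sum.If_cases)
    also have "\<dots> \<le> real (card ?B)"
      using finite_subset[OF _ fin, of ?B] by (intro of_nat_mono card_mono) auto
    finally show ?thesis .
  qed
  finally show ?thesis .
qed


section \<open>The tester\<close>

text \<open>Rejection happens only on an explicit unbalanced triangle, which is what makes the
  tester one-sided.\<close>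

primrec triangle_tests :: "'a \<Rightarrow> ('a \<times> 'a) list \<Rightarrow> 'a decision_tree" where
  "triangle_tests r [] = Verdict True"
| "triangle_tests r (e # es) =
    Query r (fst e) (\<lambda>a. Query (fst e) (snd e) (\<lambda>b. Query (snd e) r (\<lambda>c.
    Query r (snd e) (\<lambda>a'. Query (snd e) (fst e) (\<lambda>b'. Query (fst e) r (\<lambda>c'.
      if a * b * c = a' * b' * c' then triangle_tests r es else Verdict False))))))"

lemma accepts_triangle_tests:
  "accepts (pmatrix T) (triangle_tests r es) \<longleftrightarrow>
    set es \<subseteq> {(x, y). balanced_triangle T r x y}"
  by (induction es) (auto simp: balanced_triangle_def)

lemma num_queries_triangle_tests: "num_queries p (triangle_tests r es) \<le> 6 * length es"
  by (induction es) auto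

text \<open>The vertex is fixed rather than random, since the density bound holds at every vertex.
  The pairs are drawn independently with replacement, so the acceptance probability is a
  \<open>k\<close>-th power.\<close>

definition triangle_tester :: "nat \<Rightarrow> 'a query_algorithm" where
  "triangle_tester k V =
    map_pmf (triangle_tests (SOME r. r \<in> V)) (replicate_pmf k (pmf_of_set (V \<times> V)))"

lemma prob_pair_pmf_Times:
  "measure_pmf.prob (pair_pmf p q) (A \<times> B) = measure_pmf.prob p A * measure_pmf.prob q B"
proof -
  \<comment> \<open>Intersecting with the supports makes both sets countable, as the product rule
    for \<open>pmf\<close> requires.\<close>
  have "measure_pmf.prob (pair_pmf p q) (A \<times> B) =
      measure_pmf.prob (pair_pmf p q) ((A \<inter> set_pmf p) \<times> (B \<inter> set_pmf q))"
    by (subst measure_Int_set_pmf[symmetric]) (simp add: Times_Int_Times)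
  also have "\<dots> = measure_pmf.prob p (A \<inter> set_pmf p) * measure_pmf.prob q (B \<inter> set_pmf q)"
    by (intro measure_pmf_prob_product) auto
  finally show ?thesis
    by (simp add: measure_Int_set_pmf)
qed

lemma prob_replicate_pmf_subset:
  "measure_pmf.prob (replicate_pmf k p) {xs. set xs \<subseteq> A} = measure_pmf.prob p A ^ k"
proof (induction k)
  case (Suc k)
  have "replicate_pmf (Suc k) p = map_pmf (\<lambda>(x, xs). x # xs) (pair_pmf p (replicate_pmf k p))"
    by (simp add: pair_pmf_def map_bind_pmf bind_assoc_pmf bind_return_pmf)
  moreover have "(\<lambda>(x, xs). x # xs) -` {xs. set xs \<subseteq> A} = A \<times> {xs. set xs \<subseteq> A}"
    by auto
  ultimately show ?case
    by (simp add: Suc prob_pair_pmf_Times)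
qed simp

lemma accept_prob_triangle_tester:
  "accept_prob (triangle_tester k) T =
    measure_pmf.prob (pmf_of_set (verts_of T \<times> verts_of T))
      {(x, y). balanced_triangle T (SOME r. r \<in> verts_of T) x y} ^ k"
  by (simp add: accept_prob_def triangle_tester_def vimage_def accepts_triangle_tests
      prob_replicate_pmf_subset)

lemma reject_prob_eq: "reject_prob A T = 1 - accept_prob A T"
  using measure_pmf.prob_compl[of "{t. accepts (pmatrix T) t}" "A (verts_of T)"]
  by (simp add: reject_prob_def accept_prob_def Compl_eq_Diff_UNIV[symmetric] Collect_neg_eq)

text \<open>From exp 2 >= 1 + 2. This is why about 2 / \<epsilon> samples bring the error down to
  1/3.\<close>

lemma exp_minus_two_le: "exp (- 2 :: real) \<le> 1 / 3"
  using exp_ge_add_one_self[of "2 :: real"] by (simp add: exp_minus field_simps)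

lemma easily_L1_testable_All_Balanced: "easily_L1_testable (All_Balanced :: 'a stoch set)"
proof -
  \<comment> \<open>The polynomial is 6 times 2 / \<epsilon> + 1: six queries per sampled pair, and
    the ceiling adds at most 1 to the number of pairs.\<close>
  have "eps_tester \<epsilon> All_Balanced A \<and> one_sided All_Balanced A \<and>
      queries_bounded A (poly [:6, 12:] (1 / \<epsilon>))"
    if \<epsilon>: "\<epsilon> > 0" and A: "A = triangle_tester (nat \<lceil>2 / \<epsilon>\<rceil>)"
    for \<epsilon> and A :: "'a query_algorithm"
  proof -
    define k where "k = nat \<lceil>2 / \<epsilon>\<rceil>"
    have k: "real k \<ge> 2 / \<epsilon>" "real k \<le> 2 / \<epsilon> + 1"
      using \<epsilon> by (simp_all add: k_def)
    have one: "accept_prob A T = 1" if "T \<in> All_Balanced" for T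
    proof -
      have "stochastic_tournament T"
        using that by (simp add: All_Balanced_iff)
      note fin = stochastic_tournament_finite[OF this]
      have "(SOME r. r \<in> verts_of T) \<in> verts_of T"
        using fin(2) some_in_eq by blast
      \<comment> \<open>Every pair in the support passes, including those that contain
        \<open>r\<close> or repeat a vertex.\<close>
      then have "measure_pmf.prob (pmf_of_set (verts_of T \<times> verts_of T))
          {(x, y). balanced_triangle T (SOME r. r \<in> verts_of T) x y} = 1"
        using that fin
        by (subst measure_pmf.prob_eq_1) (auto simp: AE_measure_pmf_iff All_Balanced_iff)
      then show ?thesis
        by (simp add: A accept_prob_triangle_tester)
    qed
    have far: "reject_prob A T \<ge> 2 / 3"
      if T: "stochastic_tournament T" and "eps_far \<epsilon> All_Balanced T" for T
    proof -
      note fin = stochastic_tournament_finite[OF T]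
      define n where "n = card (verts_of T)"
      have n: "n > 0"
        using fin by (simp add: n_def card_gt_0_iff)
      define r where "r = (SOME r. r \<in> verts_of T)"
      have r: "r \<in> verts_of T"
        using fin(2) some_in_eq unfolding r_def by blast
      let ?G = "{(x, y). balanced_triangle T r x y}"
      let ?M = "pmf_of_set (verts_of T \<times> verts_of T)"
      have "verts_of T \<times> verts_of T \<inter> (- ?G) =
          {(x, y) \<in> verts_of T \<times> verts_of T. \<not> balanced_triangle T r x y}"
        by auto
      then have "\<epsilon> * real n ^ 2 \<le> real (card (verts_of T \<times> verts_of T \<inter> (- ?G)))"
        using eps_far_card_unbalanced[OF T r] that(2)
        by (simp add: n_def Bradley_Terry_eq_All_Balanced)
      then have "\<epsilon> \<le> measure_pmf.prob ?M (- ?G)"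
        using fin n by (simp add: measure_pmf_of_set card_cartesian_product n_def[symmetric]
            field_simps power2_eq_square)
      also have "\<dots> = 1 - measure_pmf.prob ?M ?G"
        using measure_pmf.prob_compl[of ?G ?M] by (simp add: Compl_eq_Diff_UNIV)
      finally have "measure_pmf.prob ?M ?G \<le> 1 - \<epsilon>"
        by simp
      \<comment> \<open>Passing to the exponential before taking powers avoids the sign of 1 -
        \<epsilon>, which may be negative.\<close>
      also have "\<dots> \<le> exp (- \<epsilon>)"
        using exp_ge_add_one_self[of "- \<epsilon>"] by simp
      finally have "measure_pmf.prob ?M ?G ^ k \<le> exp (- \<epsilon>) ^ k"
        by (rule power_mono) simp
      also have "\<dots> = exp (- (\<epsilon> * real k))"
        by (simp add: exp_of_nat_mult[symmetric] mult.commute)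
      also have "\<dots> \<le> exp (- 2)"
        using k(1) \<epsilon> by (simp add: field_simps)
      also have "\<dots> \<le> 1 / 3"
        by (rule exp_minus_two_le)
      finally show ?thesis
        by (simp add: reject_prob_eq A accept_prob_triangle_tester k_def r_def)
    qed
    have "real (num_queries (pmatrix T) t) \<le> poly [:6, 12:] (1 / \<epsilon>)"
      if t: "t \<in> set_pmf (A (verts_of T))" for T t
    proof -
      obtain es where es: "length es = k" "t = triangle_tests (SOME r. r \<in> verts_of T) es"
        using t by (auto simp: A triangle_tester_def set_replicate_pmf k_def)
      have "real (num_queries (pmatrix T) t) \<le> real (6 * k)"
        using num_queries_triangle_tests[of "pmatrix T"] es by (metis of_nat_mono)
      also have "\<dots> \<le> 6 * (2 / \<epsilon> + 1)"
        using k(2) by simp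
      finally show ?thesis
        by (simp add: field_simps)
    qed
    then show ?thesis
      using one far by (simp add: eps_tester_def one_sided_def queries_bounded_def)
  qed
  then show ?thesis
    unfolding easily_L1_testable_def using is_property_All_Balanced by blast
qed

theorem theorem1:
  "easily_L1_testable (Bradley_Terry :: 'a stoch set) \<and>
   easily_L1_testable (Reversible :: 'a stoch set) \<and>
   easily_L1_testable (All_Balanced :: 'a stoch set) \<and>
   easily_L1_testable (Balanced_At_Vertex :: 'a stoch set)"
  using easily_L1_testable_All_Balanced
  by (simp add: Bradley_Terry_eq_All_Balanced Reversible_eq_All_Balanced
      Balanced_At_Vertex_eq_All_Balanced)

end
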